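(* Let $A=B(X)$ for some complex Banach space $X$. Then for every linear functional $f$ on $\mathrm{Soc}\,A$ the following are equivalent: (a) $f=\alpha\,\mathrm{Tr}$ for some $\alpha\in\mathbb{C}$. (b) $f(ab)=f(ba)$ for all $a,b\in\mathrm{Soc}\,A$. (c) There exists a real number $c>0$ such that $|f(a)|\le c\cdot\mathrm{rank}(a)\cdot\rho(a)$ for all $a\in\mathrm{Soc}\,A$. (d) $f(a)=0$ for each nilpotent $a\in\mathrm{Soc}\,A$. (e) For each $a\in\mathrm{Soc}\,A$, $f(a)=0$ whenever $a^2=0$.
   Context: $B(X)$ is the Banach algebra of bounded linear operators on $X$. $\mathrm{Soc}\,B(X)$ is the two-sided ideal of bounded finite-rank operators on $X$; $\mathrm{rank}(a)$ and $\mathrm{Tr}(a)$ are the classical rank (dimension of the range) and classical trace of the finite-rank operator $a$ (these coincide with the abstract spectral notions $\mathrm{rank}(a)=\sup_{x\in A}\#(\sigma(xa)\setminus\{0\})$ and the spectral trace on the socle). $\rho(a)$ is the spectral radius. Linear functionals are complex-linear and not assumed continuous. *)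

theory Defs
  imports "HOL-Analysis.Analysis"
begin

text \<open>The real scalar multiplication and the norm are those of the underlying real Banach space.\<close>

class complex_normed_vector = real_normed_vector +
  fixes scaleC :: "complex \<Rightarrow> 'a \<Rightarrow> 'a"  (infixr "*\<^sub>C" 75)
  assumes scaleC_add_right: "c *\<^sub>C (x + y) = c *\<^sub>C x + c *\<^sub>C y"
    and scaleC_add_left: "(c + d) *\<^sub>C x = c *\<^sub>C x + d *\<^sub>C x"
    and scaleC_scaleC: "c *\<^sub>C d *\<^sub>C x = (c * d) *\<^sub>C x"
    and scaleC_of_real: "complex_of_real r *\<^sub>C x = r *\<^sub>R x"
    and norm_scaleC: "norm (c *\<^sub>C x) = cmod c * norm x"

class complex_banach = complex_normed_vector + banach

instantiation complex :: complex_banach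
begin

definition scaleC_complex :: "complex \<Rightarrow> complex \<Rightarrow> complex" where
  "scaleC_complex c x = c * x"

instance
  by standard (simp_all add: scaleC_complex_def algebra_simps norm_mult scaleR_conv_of_real)

end

interpretation complex_vector: vector_space "scaleC :: complex \<Rightarrow> 'a \<Rightarrow> 'a::complex_normed_vector"
proof
  show "1 *\<^sub>C x = x" for x :: 'a
    using scaleC_of_real[of 1 x] by simp
qed (simp_all add: scaleC_add_right scaleC_add_left scaleC_scaleC)

text \<open>The algebra \<open>B(X)\<close> is a set of functions on the type \<open>'a\<close>; its addition and scalar
  multiplication are pointwise, its product is composition, and its unit is \<open>id\<close>.\<close>

definition bounded_ops :: "('a::complex_normed_vector \<Rightarrow> 'a) set" where
  "bounded_ops = {a. bounded_linear a \<and> (\<forall>c x. a (c *\<^sub>C x) = c *\<^sub>C a x)}"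

definition soc :: "('a::complex_normed_vector \<Rightarrow> 'a) set" where
  "soc = {a \<in> bounded_ops. \<exists>B. finite B \<and> range a \<subseteq> complex_vector.span B}"

definition op_rank :: "('a::complex_normed_vector \<Rightarrow> 'a) \<Rightarrow> nat" where
  "op_rank a = complex_vector.dim (range a)"

definition trace_wrt :: "'a::complex_normed_vector set \<Rightarrow> ('a \<Rightarrow> 'a) \<Rightarrow> complex" where
  "trace_wrt B a = (\<Sum>b\<in>B. complex_vector.representation B (a b) b)"

text \<open>The trace of a finite-rank operator is the trace of its restriction to its range; by
  \<open>op_trace_eq\<close> below it does not depend on the chosen basis.\<close>

definition op_trace :: "('a::complex_normed_vector \<Rightarrow> 'a) \<Rightarrow> complex" where
  "op_trace a =
     trace_wrt (SOME B. complex_vector.independent B \<and> complex_vector.span B = range a) a"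

text \<open>If \<open>X\<close> is the zero space then the spectrum is empty and the spectral radius is an
  unspecified number; otherwise the supremum is over a nonempty bounded set.\<close>

definition op_invertible :: "('a::complex_normed_vector \<Rightarrow> 'a) \<Rightarrow> bool" where
  "op_invertible a \<longleftrightarrow> a \<in> bounded_ops \<and> (\<exists>b\<in>bounded_ops. a \<circ> b = id \<and> b \<circ> a = id)"

definition op_spectrum :: "('a::complex_normed_vector \<Rightarrow> 'a) \<Rightarrow> complex set" where
  "op_spectrum a = {l. \<not> op_invertible (\<lambda>x. l *\<^sub>C x - a x)}"

definition op_spectral_radius :: "('a::complex_normed_vector \<Rightarrow> 'a) \<Rightarrow> real" where
  "op_spectral_radius a = (SUP l\<in>op_spectrum a. cmod l)"

definition op_nilpotent :: "('a::complex_normed_vector \<Rightarrow> 'a) \<Rightarrow> bool" where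
  "op_nilpotent a \<longleftrightarrow> (\<exists>n\<ge>1. a ^^ n = (\<lambda>x. 0))"

text \<open>The values of a functional outside \<open>soc\<close> are irrelevant.\<close>

definition soc_functional :: "(('a::complex_normed_vector \<Rightarrow> 'a) \<Rightarrow> complex) \<Rightarrow> bool" where
  "soc_functional f \<longleftrightarrow>
     (\<forall>a\<in>soc. \<forall>b\<in>soc. f (\<lambda>x. a x + b x) = f a + f b) \<and>
     (\<forall>c. \<forall>a\<in>soc. f (\<lambda>x. c *\<^sub>C a x) = c * f a)"

lemma trace_wrt_basis_change:
  fixes a :: "'a::complex_normed_vector \<Rightarrow> 'a"
  assumes a: "a \<in> bounded_ops"
    and B: "complex_vector.independent B" "finite B"
    and C: "complex_vector.independent C" "finite C"
    and span: "complex_vector.span B = complex_vector.span C"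
    and inv: "a ` complex_vector.span B \<subseteq> complex_vector.span B"
  shows "trace_wrt B a = trace_wrt C a"
proof -
  let ?r = complex_vector.representation and ?V = "complex_vector.span B"
  have add: "a (x + y) = a x + a y" and scale: "a (c *\<^sub>C x) = c *\<^sub>C a x" for x y c
    using a by (auto simp: bounded_ops_def linear_simps)
  have a0: "a 0 = 0"
    using scale[of 0 0] by simp
  have a_sum: "a (\<Sum>c\<in>S. g c *\<^sub>C c) = (\<Sum>c\<in>S. g c *\<^sub>C a c)" for g :: "'a \<Rightarrow> complex" and S
    by (induction S rule: infinite_finite_induct) (simp_all add: a0 add scale)
  have rep_sum: "?r D (\<Sum>c\<in>S. g c *\<^sub>C h c) d = (\<Sum>c\<in>S. g c * ?r D (h c) d)"
    if D: "complex_vector.independent D" and h: "\<And>c. c \<in> S \<Longrightarrow> h c \<in> complex_vector.span D"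
    for D S d and g :: "'a \<Rightarrow> complex" and h :: "'a \<Rightarrow> 'a"
  proof -
    have "?r D (\<Sum>c\<in>S. g c *\<^sub>C h c) d = (\<Sum>c\<in>S. ?r D (g c *\<^sub>C h c) d)"
      using h by (subst complex_vector.representation_sum[OF D])
        (auto intro: complex_vector.span_scale)
    also have "\<dots> = (\<Sum>c\<in>S. g c * ?r D (h c) d)"
      using h by (intro sum.cong) (simp_all add: complex_vector.representation_scale[OF D])
    finally show ?thesis .
  qed
  have BV: "b \<in> ?V" if "b \<in> B" for b using that by (rule complex_vector.span_base)
  have CV: "c \<in> ?V" if "c \<in> C" for c using that span by (auto intro: complex_vector.span_base)
  have aV: "a x \<in> ?V" if "x \<in> ?V" for x using that inv by auto
  have expC: "(\<Sum>c\<in>C. ?r C x c *\<^sub>C c) = x" if "x \<in> ?V" for x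
    using that C span by (intro complex_vector.sum_representation_eq) auto
  have expB: "(\<Sum>b\<in>B. ?r B x b *\<^sub>C b) = x" if "x \<in> ?V" for x
    using that B by (intro complex_vector.sum_representation_eq) auto
  have "trace_wrt B a = (\<Sum>b\<in>B. \<Sum>c\<in>C. ?r C b c * ?r B (a c) b)"
    unfolding trace_wrt_def
  proof (rule sum.cong[OF refl])
    fix b assume "b \<in> B"
    then have "a b = (\<Sum>c\<in>C. ?r C b c *\<^sub>C a c)"
      using a_sum[of "?r C b" C] expC[OF BV] by simp
    then show "?r B (a b) b = (\<Sum>c\<in>C. ?r C b c * ?r B (a c) b)"
      using rep_sum[OF B(1), of C a] CV aV by simp
  qed
  also have "\<dots> = (\<Sum>c\<in>C. \<Sum>b\<in>B. ?r B (a c) b * ?r C b c)"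
    by (subst sum.swap) (simp add: mult.commute)
  also have "\<dots> = trace_wrt C a"
    unfolding trace_wrt_def
  proof (rule sum.cong[OF refl])
    fix c assume "c \<in> C"
    then show "(\<Sum>b\<in>B. ?r B (a c) b * ?r C b c) = ?r C (a c) c"
      using rep_sum[OF C(1), of B "\<lambda>b. b" "?r B (a c)" c] BV expB[OF aV[OF CV]] span by simp
  qed
  finally show ?thesis .
qed

lemma op_trace_eq:
  fixes a :: "'a::complex_normed_vector \<Rightarrow> 'a"
  assumes a: "a \<in> soc"
    and B: "complex_vector.independent B" "complex_vector.span B = range a"
  shows "op_trace a = trace_wrt B a"
proof -
  obtain F where F: "finite F" "range a \<subseteq> complex_vector.span F"
    using a by (auto simp: soc_def)
  have fin: "finite D" if "complex_vector.independent D" "complex_vector.span D = range a" for D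
    using complex_vector.independent_span_bound[OF F(1) that(1)] that(2) F(2)
      complex_vector.span_superset[of D] by auto
  define C where "C = (SOME C. complex_vector.independent C \<and> complex_vector.span C = range a)"
  have C: "complex_vector.independent C" "complex_vector.span C = range a"
    unfolding C_def using someI[where P = "\<lambda>C. complex_vector.independent C \<and>
      complex_vector.span C = range a", OF conjI[OF B]] by auto
  show ?thesis
    unfolding op_trace_def C_def[symmetric]
    by (rule trace_wrt_basis_change) (use a B C fin in \<open>auto simp: soc_def\<close>)
qed

end

theory Submission
  imports Defs "HOL-Computational_Algebra.Fundamental_Theorem_Algebra"
begin

text \<open>Each of (b), (c), (d), (e) forces \<open>f\<close> to vanish on the rank-one operators \<open>y \<mapsto> \<phi>(y) x\<close> with
  \<open>\<phi>(x) = 0\<close>, whose square is zero. By linearity \<open>f\<close> is then a constant multiple of \<open>\<phi>(x)\<close> on all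
  rank-one operators: two pairs \<open>(x, \<phi>)\<close>, \<open>(y, \<psi>)\<close> are linked by changing the vector and the
  functional one at a time. A finite-rank operator is the sum of the rank-one operators \<open>\<phi>\<^sub>b(y) b\<close> over
  a basis of its range, where the coordinate functionals \<open>\<phi>\<^sub>b\<close> are bounded because finite-dimensional
  subspaces are closed, and its trace is the sum of the values \<open>\<phi>\<^sub>b(b)\<close>. Conversely, the trace is a sum of
  \<open>rank(a)\<close> eigenvalues of \<open>a\<close>, each bounded by the spectral radius and zero if \<open>a\<close> is nilpotent.\<close>

section \<open>Finite-rank operators and linear functionals on them\<close>

lemma bounded_ops_linear:
  assumes "a \<in> bounded_ops"
  shows "Vector_Spaces.linear scaleC scaleC a"
  using assms by unfold_locales (auto simp: bounded_ops_def linear_simps)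

lemma socI:
  assumes "a \<in> bounded_ops" "finite B" "range a \<subseteq> complex_vector.span B"
  shows "a \<in> soc"
  using assms by (auto simp: soc_def)

lemma soc_bounded_ops: "a \<in> soc \<Longrightarrow> a \<in> bounded_ops"
  by (simp add: soc_def)

lemma bounded_linear_scaleC_right: "bounded_linear (\<lambda>x::'a::complex_normed_vector. c *\<^sub>C x)"
proof (rule bounded_linear_intro[where K = "cmod c"])
  show "c *\<^sub>C (r *\<^sub>R x) = r *\<^sub>R (c *\<^sub>C x)" for r and x :: 'a
    by (simp flip: scaleC_of_real add: scaleC_scaleC mult.commute)
qed (simp_all add: scaleC_add_right norm_scaleC)

lemma bounded_linear_scaleC_left: "bounded_linear (\<lambda>c. c *\<^sub>C (x::'a::complex_normed_vector))"
proof (rule bounded_linear_intro[where K = "norm x"])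
  show "(r *\<^sub>R c) *\<^sub>C x = r *\<^sub>R (c *\<^sub>C x)" for r c
    by (metis scaleC_of_real scaleC_scaleC scaleR_conv_of_real)
qed (simp_all add: scaleC_add_left norm_scaleC)

lemma soc_zero: "(\<lambda>x. 0) \<in> soc"
  by (rule socI[where B = "{}"]) (auto simp: bounded_ops_def)

lemma soc_add:
  assumes "a \<in> soc" "b \<in> soc"
  shows "(\<lambda>x. a x + b x) \<in> soc"
proof -
  obtain A B where A: "finite A" "range a \<subseteq> complex_vector.span A"
    and B: "finite B" "range b \<subseteq> complex_vector.span B"
    using assms by (auto simp: soc_def)
  have "complex_vector.span A \<subseteq> complex_vector.span (A \<union> B)"
    "complex_vector.span B \<subseteq> complex_vector.span (A \<union> B)"
    by (simp_all add: complex_vector.span_mono)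
  then have "range (\<lambda>x. a x + b x) \<subseteq> complex_vector.span (A \<union> B)"
    using A(2) B(2) by (auto intro!: complex_vector.span_add)
  moreover have "(\<lambda>x. a x + b x) \<in> bounded_ops"
    using assms by (auto simp: soc_def bounded_ops_def bounded_linear_add scaleC_add_right)
  ultimately show ?thesis
    using A(1) B(1) by (intro socI[where B = "A \<union> B"]) auto
qed

lemma soc_scale:
  assumes "a \<in> soc"
  shows "(\<lambda>x. c *\<^sub>C a x) \<in> soc"
proof -
  obtain A where A: "finite A" "range a \<subseteq> complex_vector.span A"
    using assms by (auto simp: soc_def)
  then have "range (\<lambda>x. c *\<^sub>C a x) \<subseteq> complex_vector.span A"
    by (auto intro!: complex_vector.span_scale)
  moreover have "(\<lambda>x. c *\<^sub>C a x) \<in> bounded_ops"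
    using assms bounded_linear_compose[OF bounded_linear_scaleC_right]
    by (auto simp: soc_def bounded_ops_def scaleC_scaleC mult.commute)
  ultimately show ?thesis
    using A(1) by (intro socI)
qed

lemma soc_sum:
  assumes "\<And>i. i \<in> I \<Longrightarrow> a i \<in> soc"
  shows "(\<lambda>x. \<Sum>i\<in>I. a i x) \<in> soc"
  using assms by (induction I rule: infinite_finite_induct) (simp_all add: soc_zero soc_add)

lemma bounded_ops_comp:
  assumes "a \<in> bounded_ops" "b \<in> bounded_ops"
  shows "a \<circ> b \<in> bounded_ops"
  using assms by (auto simp: bounded_ops_def bounded_linear_compose o_def)

lemma soc_comp:
  assumes "a \<in> soc" "b \<in> soc"
  shows "a \<circ> b \<in> soc"
proof -
  obtain A where A: "finite A" "range a \<subseteq> complex_vector.span A"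
    using assms by (auto simp: soc_def)
  then show ?thesis
    using assms by (intro socI[OF bounded_ops_comp A(1)]) (auto simp: soc_def)
qed

lemma soc_functional_scale:
  assumes "soc_functional f" "a \<in> soc"
  shows "f (\<lambda>x. c *\<^sub>C a x) = c * f a"
  using assms unfolding soc_functional_def by blast

lemma soc_functional_zero:
  assumes "soc_functional f"
  shows "f (\<lambda>x. 0) = 0"
  using soc_functional_scale[OF assms soc_zero, of 0] by simp

lemma soc_functional_add:
  assumes "soc_functional f" "a \<in> soc" "b \<in> soc"
  shows "f (\<lambda>x. a x + b x) = f a + f b"
  using assms unfolding soc_functional_def by blast

lemma soc_functional_lincomb:
  assumes "soc_functional f" "a \<in> soc" "b \<in> soc"
  shows "f (\<lambda>x. c *\<^sub>C a x + d *\<^sub>C b x) = c * f a + d * f b"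
  using soc_functional_add[OF assms(1) soc_scale[OF assms(2)] soc_scale[OF assms(3)], of c d]
    soc_functional_scale[OF assms(1,2)] soc_functional_scale[OF assms(1,3)]
  by simp

lemma soc_functional_sum:
  assumes "soc_functional f" "\<And>i. i \<in> I \<Longrightarrow> a i \<in> soc"
  shows "f (\<lambda>x. \<Sum>i\<in>I. a i x) = (\<Sum>i\<in>I. f (a i))"
  using assms(2)
  by (induction I rule: infinite_finite_induct)
    (simp_all add: soc_functional_zero[OF assms(1)] soc_functional_add[OF assms(1)] soc_sum)

subsection \<open>Rank-one operators\<close>

text \<open>The dual space. Complex homogeneity is a separate clause because
  \<open>bounded_linear\<close> expresses linearity over the reals only.\<close>

definition bounded_functional :: "('a::complex_normed_vector \<Rightarrow> complex) \<Rightarrow> bool" where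
  "bounded_functional \<phi> \<longleftrightarrow> bounded_linear \<phi> \<and> (\<forall>c x. \<phi> (c *\<^sub>C x) = c * \<phi> x)"

definition rank_one :: "'a::complex_normed_vector \<Rightarrow> ('a \<Rightarrow> complex) \<Rightarrow> 'a \<Rightarrow> 'a" where
  "rank_one x \<phi> y = \<phi> y *\<^sub>C x"

lemma rank_one_soc:
  assumes "bounded_functional \<phi>"
  shows "rank_one x \<phi> \<in> soc"
proof (rule socI[where B = "{x}"])
  have "bounded_linear (\<lambda>y. \<phi> y *\<^sub>C x)"
    using assms bounded_linear_compose[OF bounded_linear_scaleC_left]
    unfolding bounded_functional_def by blast
  then show "rank_one x \<phi> \<in> bounded_ops"
    using assms
    by (simp add: bounded_ops_def bounded_functional_def rank_one_def[abs_def] scaleC_scaleC)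
  show "range (rank_one x \<phi>) \<subseteq> complex_vector.span {x}"
    by (auto simp: rank_one_def complex_vector.span_scale complex_vector.span_base)
qed simp

lemma rank_one_square:
  assumes "bounded_functional \<phi>" "\<phi> x = 0"
  shows "rank_one x \<phi> \<circ> rank_one x \<phi> = (\<lambda>y. 0)"
  using assms by (auto simp: rank_one_def bounded_functional_def fun_eq_iff)

text \<open>Coefficients are attached to indices, so repeated values of \<open>g\<close> cause no
  trouble; \<open>g\<close> will list the iterates of a vector.\<close>

lemma span_image_finite_sum:
  assumes "finite I" "x \<in> complex_vector.span (g ` I)"
  shows "\<exists>u. x = (\<Sum>i\<in>I. u i *\<^sub>C g i)"
  using assms(2)
proof (induction rule: complex_vector.span_induct_alt)
  case base
  show ?case by (rule exI[of _ "\<lambda>_. 0"]) simp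
next
  case (step c y z)
  then obtain i u where i: "i \<in> I" "y = g i" and u: "z = (\<Sum>i\<in>I. u i *\<^sub>C g i)"
    by auto
  have "(\<Sum>j\<in>I. ((if j = i then c else 0) + u j) *\<^sub>C g j)
      = (\<Sum>j\<in>I. (if j = i then c *\<^sub>C g j else 0)) + z"
    by (simp add: scaleC_add_left u if_distrib[of "\<lambda>c. c *\<^sub>C _"] sum.distrib cong: if_cong)
  then show ?case
    using i assms(1) by (intro exI[of _ "\<lambda>j. (if j = i then c else 0) + u j"]) simp
qed

section \<open>Closed finite-dimensional subspaces and bounded coordinates\<close>

lemma dist_span_pos:
  assumes "closed (complex_vector.span F)" "b \<notin> complex_vector.span F"
  obtains d where "d > 0" "\<And>c v. v \<in> complex_vector.span F \<Longrightarrow> cmod c * d \<le> norm (c *\<^sub>C b + v)"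
proof -
  let ?V = "complex_vector.span F"
  \<comment> \<open>The distance from \<open>b\<close> to the closed span is positive; dividing
    \<open>c *\<^sub>C b + v\<close> by a nonzero \<open>c\<close> leaves \<open>b\<close> minus a
    point of the span.\<close>
  let ?d = "infdist b ?V"
  have ne: "?V \<noteq> {}"
    using complex_vector.span_zero by auto
  have "?d > 0"
    using in_closed_iff_infdist_zero[OF assms(1) ne, of b] assms(2) infdist_nonneg[of b ?V]
    by simp
  moreover have "cmod c * ?d \<le> norm (c *\<^sub>C b + v)" if v: "v \<in> ?V" for c v
  proof (cases "c = 0")
    case False
    have "(- inverse c) *\<^sub>C v \<in> ?V"
      using v by (rule complex_vector.span_scale)
    then have "?d \<le> dist b ((- inverse c) *\<^sub>C v)"
      by (rule infdist_le)
    then have "cmod c * ?d \<le> cmod c * norm (b + inverse c *\<^sub>C v)"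
      by (simp add: dist_norm mult_left_mono)
    also have "\<dots> = norm (c *\<^sub>C (b + inverse c *\<^sub>C v))"
      by (simp add: norm_scaleC)
    also have "c *\<^sub>C (b + inverse c *\<^sub>C v) = c *\<^sub>C b + v"
      using False by (simp add: scaleC_add_right scaleC_scaleC)
    finally show ?thesis .
  qed simp
  ultimately show thesis
    using that by blast
qed

text \<open>Induction on the spanning set. If \<open>b\<close> is outside the span of
  \<open>F\<close>, the coefficients of \<open>b\<close> along a convergent sequence are Cauchy; the
  remainders then converge inside the closed span of \<open>F\<close>.\<close>

lemma closed_span_finite:
  fixes F :: "'a::complex_normed_vector set"
  assumes "finite F"
  shows "closed (complex_vector.span F)"
  using assms
proof (induction F)
  case (insert b F)
  let ?V = "complex_vector.span F"
  show ?case
  proof (cases "b \<in> ?V")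
    case True
    then show ?thesis
      using insert.IH by (simp add: complex_vector.span_redundant)
  next
    case False
    obtain d where d: "d > 0" "\<And>c v. v \<in> ?V \<Longrightarrow> cmod c * d \<le> norm (c *\<^sub>C b + v)"
      using dist_span_pos[OF insert.IH False] by blast
    show ?thesis
      unfolding closed_sequential_limits
    proof safe
      fix x l assume x: "\<forall>n. x n \<in> complex_vector.span (insert b F)" and l: "x \<longlonglongrightarrow> l"
      have "\<forall>n. \<exists>k. x n - k *\<^sub>C b \<in> ?V"
        using x by (simp add: complex_vector.span_insert)
      then obtain k where k: "\<And>n. x n - k n *\<^sub>C b \<in> ?V"
        by metis
      have "Cauchy k"
        unfolding Cauchy_def
      proof safe
        fix e :: real assume "e > 0"
        then have "e * d > 0"
          using d(1) by simp
        then obtain M where M: "\<And>m n. m \<ge> M \<Longrightarrow> n \<ge> M \<Longrightarrow> dist (x m) (x n) < e * d"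
          using LIMSEQ_imp_Cauchy[OF l] unfolding Cauchy_def by blast
        have "dist (k m) (k n) < e" if mn: "m \<ge> M" "n \<ge> M" for m n
        proof -
          have "(x m - k m *\<^sub>C b) - (x n - k n *\<^sub>C b) \<in> ?V"
            by (rule complex_vector.span_diff[OF k k])
          from d(2)[OF this, of "k m - k n"] have "cmod (k m - k n) * d \<le> norm (x m - x n)"
            by (simp add: complex_vector.scale_left_diff_distrib algebra_simps)
          also have "\<dots> < e * d"
            using M[OF mn] by (simp add: dist_norm)
          finally show ?thesis
            using d(1) by (simp add: dist_norm)
        qed
        then show "\<exists>M. \<forall>m\<ge>M. \<forall>n\<ge>M. dist (k m) (k n) < e"
          by blast
      qed
      then obtain c where c: "k \<longlonglongrightarrow> c"
        using Cauchy_convergent convergent_def by blast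
      have "(\<lambda>n. x n - k n *\<^sub>C b) \<longlonglongrightarrow> l - c *\<^sub>C b"
        by (intro tendsto_diff l bounded_linear.tendsto[OF bounded_linear_scaleC_left] c)
      then have "l - c *\<^sub>C b \<in> ?V"
        by (rule closed_sequentially[OF insert.IH k])
      then show "l \<in> complex_vector.span (insert b F)"
        by (auto simp: complex_vector.span_insert)
    qed
  qed
qed simp

text \<open>By independence \<open>b\<close> stays away from the closed span of the other basis
  vectors; the constant \<open>d\<close> measuring this yields \<open>inverse d\<close> for
  \<open>K\<close>.\<close>

lemma representation_bounded:
  fixes B :: "'a::complex_normed_vector set"
  assumes B: "complex_vector.independent B" "finite B" and b: "b \<in> B"
  obtains K where
    "\<And>x. x \<in> complex_vector.span B \<Longrightarrow> cmod (complex_vector.representation B x b) \<le> K * norm x"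
proof -
  let ?F = "B - {b}" and ?r = "complex_vector.representation B"
  have "b \<notin> complex_vector.span ?F"
    using B(1) b complex_vector.dependent_def by blast
  then obtain d where d: "d > 0"
    "\<And>c v. v \<in> complex_vector.span ?F \<Longrightarrow> cmod c * d \<le> norm (c *\<^sub>C b + v)"
    using dist_span_pos[OF closed_span_finite] B(2) by blast
  show thesis
  proof (rule that)
    fix x assume x: "x \<in> complex_vector.span B"
    have "x = (\<Sum>v\<in>B. ?r x v *\<^sub>C v)"
      using complex_vector.sum_representation_eq[OF B(1) x B(2)] by simp
    also have "\<dots> = ?r x b *\<^sub>C b + (\<Sum>v\<in>?F. ?r x v *\<^sub>C v)"
      using B(2) b by (rule sum.remove)
    finally have "x = ?r x b *\<^sub>C b + (\<Sum>v\<in>?F. ?r x v *\<^sub>C v)" .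
    moreover have "(\<Sum>v\<in>?F. ?r x v *\<^sub>C v) \<in> complex_vector.span ?F"
      by (intro complex_vector.span_sum complex_vector.span_scale complex_vector.span_base)
    ultimately have "cmod (?r x b) * d \<le> norm x"
      using d(2) by metis
    then show "cmod (?r x b) \<le> inverse d * norm x"
      using d(1) by (simp add: field_simps)
  qed
qed

lemma soc_range_basis:
  assumes "a \<in> soc"
  obtains B where "complex_vector.independent B" "finite B" "complex_vector.span B = range a"
proof -
  obtain F where F: "finite F" "range a \<subseteq> complex_vector.span F"
    using assms by (auto simp: soc_def)
  interpret Vector_Spaces.linear scaleC scaleC a
    using assms by (intro bounded_ops_linear soc_bounded_ops)
  obtain B where B: "B \<subseteq> range a" "complex_vector.independent B"
    "range a \<subseteq> complex_vector.span B"
    using complex_vector.maximal_independent_subset by blast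
  have "complex_vector.subspace (range a)"
    by (rule subspace_image) (rule complex_vector.subspace_UNIV)
  then have "complex_vector.span B = range a"
    using B by (metis complex_vector.span_subspace)
  moreover have "finite B"
    using complex_vector.independent_span_bound[OF F(1) B(2)] B(1) F(2) by blast
  ultimately show thesis
    using that B(2) by blast
qed

text \<open>Coordinates are meaningful only on the span of \<open>B\<close>; precomposition with
  \<open>a\<close>, which maps into that span, gives a functional on the whole space.\<close>

lemma bounded_functional_coordinate:
  fixes a :: "'a::complex_normed_vector \<Rightarrow> 'a"
  assumes a: "a \<in> bounded_ops" "range a \<subseteq> complex_vector.span B"
    and B: "complex_vector.independent B" "finite B" and b: "b \<in> B"
  shows "bounded_functional (\<lambda>x. complex_vector.representation B (a x) b)"
proof -
  interpret Vector_Spaces.linear scaleC scaleC a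
    using a(1) by (rule bounded_ops_linear)
  have V: "a x \<in> complex_vector.span B" for x
    using a(2) by auto
  obtain K where K: "cmod (complex_vector.representation B x b) \<le> K * norm x"
    if "x \<in> complex_vector.span B" for x
    using representation_bounded[OF B b] by metis
  obtain M where M: "\<And>x. norm (a x) \<le> norm x * M"
    using a(1) bounded_linear.bounded unfolding bounded_ops_def by blast
  have hom: "complex_vector.representation B (a (c *\<^sub>C x)) b
      = c * complex_vector.representation B (a x) b" for c x
    using V by (simp add: scale complex_vector.representation_scale[OF B(1)])
  have "bounded_linear (\<lambda>x. complex_vector.representation B (a x) b)"
  proof (rule bounded_linear_intro[where K = "\<bar>K\<bar> * M"])
    show "complex_vector.representation B (a (x + y)) b
        = complex_vector.representation B (a x) b + complex_vector.representation B (a y) b" for x y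
      using V by (simp add: add complex_vector.representation_add[OF B(1)])
    show "complex_vector.representation B (a (r *\<^sub>R x)) b
        = r *\<^sub>R complex_vector.representation B (a x) b" for r x
      using hom[of "complex_of_real r" x] by (simp add: scaleC_of_real scaleR_conv_of_real)
    show "cmod (complex_vector.representation B (a x) b) \<le> norm x * (\<bar>K\<bar> * M)" for x
    proof -
      have "cmod (complex_vector.representation B (a x) b) \<le> K * norm (a x)"
        by (rule K[OF V])
      also have "\<dots> \<le> \<bar>K\<bar> * norm (a x)"
        by (simp add: mult_right_mono)
      also have "\<dots> \<le> \<bar>K\<bar> * (norm x * M)"
        by (simp add: M mult_left_mono)
      finally show ?thesis
        by (simp add: mult_ac)
    qed
  qed
  then show ?thesis
    using hom by (simp add: bounded_functional_def)
qed

text \<open>\<open>a x\<close> is expanded in a basis of the range, with its coordinates as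
  functionals; their values at the basis vectors are the diagonal entries summed by the
  trace.\<close>

lemma soc_eq_sum_rank_one:
  fixes a :: "'a::complex_normed_vector \<Rightarrow> 'a"
  assumes "a \<in> soc"
  obtains B \<phi> where "finite B" "\<And>b. b \<in> B \<Longrightarrow> bounded_functional (\<phi> b)"
    "a = (\<lambda>x. \<Sum>b\<in>B. rank_one b (\<phi> b) x)" "op_trace a = (\<Sum>b\<in>B. \<phi> b b)"
proof -
  obtain B where B: "complex_vector.independent B" "finite B" "complex_vector.span B = range a"
    using soc_range_basis[OF assms] .
  let ?\<phi> = "\<lambda>b x. complex_vector.representation B (a x) b"
  show thesis
  proof (rule that[of B ?\<phi>])
    show "a = (\<lambda>x. \<Sum>b\<in>B. rank_one b (?\<phi> b) x)"
      using B by (auto simp: rank_one_def complex_vector.sum_representation_eq)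
    show "op_trace a = (\<Sum>b\<in>B. ?\<phi> b b)"
      using op_trace_eq[OF assms B(1,3)] by (simp add: trace_wrt_def)
  qed (use B assms in \<open>auto intro!: bounded_functional_coordinate simp: soc_def\<close>)
qed

section \<open>Functionals vanishing on square-zero rank-one operators\<close>

lemma rank_one_add_left:
  "rank_one (x + y) \<phi> = (\<lambda>z. rank_one x \<phi> z + rank_one y \<phi> z)"
  by (simp add: rank_one_def scaleC_add_right fun_eq_iff)

lemma rank_one_scale_left: "rank_one (c *\<^sub>C x) \<phi> = (\<lambda>z. c *\<^sub>C rank_one x \<phi> z)"
  by (simp add: rank_one_def scaleC_scaleC fun_eq_iff mult.commute)

lemma rank_one_add_right:
  "rank_one x (\<lambda>z. \<phi> z + \<psi> z) = (\<lambda>z. rank_one x \<phi> z + rank_one x \<psi> z)"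
  by (simp add: rank_one_def scaleC_add_left fun_eq_iff)

lemma rank_one_scale_right: "rank_one x (\<lambda>z. c * \<phi> z) = (\<lambda>z. c *\<^sub>C rank_one x \<phi> z)"
  by (simp add: rank_one_def scaleC_scaleC fun_eq_iff)

lemma bounded_functional_add:
  "bounded_functional \<phi> \<Longrightarrow> bounded_functional \<psi> \<Longrightarrow> bounded_functional (\<lambda>z. \<phi> z + \<psi> z)"
  by (simp add: bounded_functional_def bounded_linear_add ring_distribs)

lemma bounded_functional_scale:
  "bounded_functional \<phi> \<Longrightarrow> bounded_functional (\<lambda>z. c * \<phi> z)"
  by (simp add: bounded_functional_def bounded_linear_const_mult)

text \<open>\<open>f (rank_one x \<phi>)\<close> is bilinear in \<open>x\<close> and
  \<open>\<phi>\<close> and vanishes whenever \<open>\<phi> x\<close> does, hence is a constant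
  multiple of \<open>\<phi> x\<close>.\<close>

lemma functional_multiple_of_trace:
  fixes f :: "('a::complex_normed_vector \<Rightarrow> 'a) \<Rightarrow> complex"
  assumes f: "soc_functional f"
    and null: "\<And>\<phi> x. bounded_functional \<phi> \<Longrightarrow> \<phi> x = 0 \<Longrightarrow> f (rank_one x \<phi>) = 0"
  shows "\<exists>\<alpha>. \<forall>a\<in>soc. f a = \<alpha> * op_trace a"
proof -
  \<comment> \<open>The vector \<open>\<phi> y *\<^sub>C x + (- \<phi> x) *\<^sub>C y\<close> lies
    in the kernel of \<open>\<phi>\<close>.\<close>
  have vector: "\<phi> y * f (rank_one x \<phi>) = \<phi> x * f (rank_one y \<phi>)"
    if \<phi>: "bounded_functional \<phi>" for \<phi> x y
  proof -
    interpret bounded_linear \<phi>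
      using \<phi> by (simp add: bounded_functional_def)
    have "\<phi> (\<phi> y *\<^sub>C x + (- \<phi> x) *\<^sub>C y) = 0"
      using \<phi> by (simp only: add bounded_functional_def) simp
    moreover have "rank_one (\<phi> y *\<^sub>C x + (- \<phi> x) *\<^sub>C y) \<phi>
        = (\<lambda>z. \<phi> y *\<^sub>C rank_one x \<phi> z + (- \<phi> x) *\<^sub>C rank_one y \<phi> z)"
      by (simp only: rank_one_add_left rank_one_scale_left)
    ultimately have "f (\<lambda>z. \<phi> y *\<^sub>C rank_one x \<phi> z + (- \<phi> x) *\<^sub>C rank_one y \<phi> z) = 0"
      using null[OF \<phi>] by metis
    then show ?thesis
      unfolding soc_functional_lincomb[OF f rank_one_soc[OF \<phi>] rank_one_soc[OF \<phi>]] by simp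
  qed
  \<comment> \<open>The combination of \<open>\<phi>\<close> and \<open>\<psi>\<close> with
    coefficients \<open>\<psi> x\<close> and \<open>- \<phi> x\<close> vanishes at
    \<open>x\<close>.\<close>
  have functional: "\<psi> x * f (rank_one x \<phi>) = \<phi> x * f (rank_one x \<psi>)"
    if \<phi>: "bounded_functional \<phi>" and \<psi>: "bounded_functional \<psi>" for \<phi> \<psi> x
  proof -
    have "bounded_functional (\<lambda>z. \<psi> x * \<phi> z + (- \<phi> x) * \<psi> z)"
      by (intro bounded_functional_add bounded_functional_scale \<phi> \<psi>)
    moreover have "\<psi> x * \<phi> x + (- \<phi> x) * \<psi> x = 0"
      by simp
    ultimately have "f (rank_one x (\<lambda>z. \<psi> x * \<phi> z + (- \<phi> x) * \<psi> z)) = 0"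
      by (rule null)
    then show ?thesis
      unfolding rank_one_add_right rank_one_scale_right
        soc_functional_lincomb[OF f rank_one_soc[OF \<phi>] rank_one_soc[OF \<psi>]] by simp
  qed
  have "\<exists>\<alpha>. \<forall>\<phi> x. bounded_functional \<phi> \<longrightarrow> f (rank_one x \<phi>) = \<alpha> * \<phi> x"
  proof (cases "\<exists>\<phi> (x::'a). bounded_functional \<phi> \<and> \<phi> x \<noteq> 0")
    case False
    then show ?thesis
      using null by (intro exI[of _ 0]) auto
  next
    case True
    then obtain \<psi> y where \<psi>: "bounded_functional \<psi>" "\<psi> (y::'a) \<noteq> 0"
      by blast
    \<comment> \<open>One pair with \<open>\<psi> y \<noteq> 0\<close> determines the constant.
      Changing first the vector and then the functional reaches every pair with
      \<open>\<psi> x \<noteq> 0\<close>.\<close>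
    let ?\<alpha> = "f (rank_one y \<psi>) / \<psi> y"
    have at_\<psi>: "f (rank_one x \<psi>) = ?\<alpha> * \<psi> x" for x
      using vector[OF \<psi>(1), of y x] \<psi>(2) by (simp add: field_simps)
    have off_kernel: "f (rank_one x \<phi>) = ?\<alpha> * \<phi> x"
      if "bounded_functional \<phi>" "\<psi> x \<noteq> 0" for \<phi> x
    proof -
      have "\<psi> x * f (rank_one x \<phi>) = \<psi> x * (?\<alpha> * \<phi> x)"
        using functional[OF that(1) \<psi>(1), of x] at_\<psi>[of x] by simp
      then show ?thesis
        using that(2) by (simp only: mult_cancel_left) simp
    qed
    have "f (rank_one x \<phi>) = ?\<alpha> * \<phi> x" if \<phi>: "bounded_functional \<phi>" for \<phi> x
    proof (cases "\<psi> x = 0")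
      \<comment> \<open>Here both \<open>x + y\<close> and \<open>y\<close> avoid the kernel of
        \<open>\<psi>\<close>, and the claim for \<open>x\<close> is the difference of the claims
        for these two.\<close>
      case True
      then have "\<psi> (x + y) \<noteq> 0"
        using \<psi> by (simp add: bounded_functional_def linear_simps)
      then have "f (rank_one (x + y) \<phi>) = ?\<alpha> * \<phi> (x + y)"
        by (rule off_kernel[OF \<phi>])
      moreover have "f (rank_one (x + y) \<phi>) = f (rank_one x \<phi>) + f (rank_one y \<phi>)"
        using \<phi> by (simp add: rank_one_add_left rank_one_soc soc_functional_add[OF f])
      moreover have "\<phi> (x + y) = \<phi> x + \<phi> y"
        using \<phi> by (simp add: bounded_functional_def linear_simps)
      ultimately show ?thesis
        using off_kernel[OF \<phi> \<psi>(2)] by (simp add: ring_distribs)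
    qed (rule off_kernel[OF \<phi>])
    then show ?thesis
      by blast
  qed
  then obtain \<alpha> where \<alpha>: "\<And>\<phi> x. bounded_functional \<phi> \<Longrightarrow> f (rank_one x \<phi>) = \<alpha> * \<phi> x"
    by blast
  have "f a = \<alpha> * op_trace a" if soc: "a \<in> soc" for a
  proof -
    obtain B \<phi> where B: "finite B" "\<And>b. b \<in> B \<Longrightarrow> bounded_functional (\<phi> b)"
      and a: "a = (\<lambda>x. \<Sum>b\<in>B. rank_one b (\<phi> b) x)" and tr: "op_trace a = (\<Sum>b\<in>B. \<phi> b b)"
      using soc_eq_sum_rank_one[OF soc] by blast
    have "f a = (\<Sum>b\<in>B. f (rank_one b (\<phi> b)))"
      unfolding a using B by (intro soc_functional_sum f rank_one_soc)
    then show ?thesis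
      using B(2) by (simp add: \<alpha> tr sum_distrib_left)
  qed
  then show ?thesis
    by blast
qed

subsection \<open>Traces and eigenvalues\<close>

text \<open>All \<open>a c\<close> lie in the span of \<open>B\<close>, so their coordinates at
  vectors outside \<open>B\<close> are zero.\<close>

lemma trace_wrt_superset:
  assumes B: "B \<subseteq> C"
    and C: "complex_vector.independent C" "finite C"
    and a: "\<And>c. c \<in> C \<Longrightarrow> a c \<in> complex_vector.span B"
  shows "trace_wrt C a = trace_wrt B a"
proof -
  have "trace_wrt C a = (\<Sum>c\<in>C. complex_vector.representation B (a c) c)"
    unfolding trace_wrt_def
    using complex_vector.representation_extend[OF C(1) a B] by (intro sum.cong) auto
  also have "\<dots> = trace_wrt B a"
    unfolding trace_wrt_def
    using B C(2) complex_vector.representation_ne_zero by (intro sum.mono_neutral_right) blast+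
  finally show ?thesis .
qed

lemma extend_basis_of_span:
  assumes B: "complex_vector.independent B" "finite B"
    and E: "complex_vector.independent E" "E \<subseteq> complex_vector.span B"
  obtains F where "E \<subseteq> F" "complex_vector.independent F" "finite F"
    "complex_vector.span F = complex_vector.span B" "card F = card B"
proof -
  obtain F where F: "E \<subseteq> F" "F \<subseteq> complex_vector.span B" "complex_vector.independent F"
    "complex_vector.span B \<subseteq> complex_vector.span F"
    using complex_vector.maximal_independent_subset_extend[OF E(2,1)] by metis
  have span: "complex_vector.span F = complex_vector.span B"
    using F(4) complex_vector.span_minimal[OF F(2) complex_vector.subspace_span] by blast
  have "finite F"
    using complex_vector.independent_span_bound[OF B(2) F(3,2)] by blast
  moreover have "card F = card B"
    using complex_vector.dim_span_eq_card_independent F(3) B(1) span by metis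
  ultimately show thesis
    using that F span by blast
qed

text \<open>Lets several operators share one basis. A basis of the range is extended within the span
  of \<open>C\<close>; the added vectors contribute nothing to the trace.\<close>

lemma op_trace_eq_superset:
  assumes a: "a \<in> soc" and C: "complex_vector.independent C" "finite C"
    and range: "range a \<subseteq> complex_vector.span C"
  shows "op_trace a = trace_wrt C a"
proof -
  obtain B where B: "complex_vector.independent B" "finite B" "complex_vector.span B = range a"
    using soc_range_basis[OF a] .
  have "B \<subseteq> complex_vector.span C"
    using B(3) range complex_vector.span_superset by blast
  then obtain D where D: "B \<subseteq> D" "complex_vector.independent D" "finite D"
    "complex_vector.span D = complex_vector.span C"
    using extend_basis_of_span[OF C B(1)] by metis
  then have "trace_wrt C a = trace_wrt D a"
    using a C range by (intro trace_wrt_basis_change) (auto simp: soc_def)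
  also have "\<dots> = trace_wrt B a"
    using B(3) by (intro trace_wrt_superset D) auto
  finally show ?thesis
    using op_trace_eq[OF a B(1,3)] by simp
qed

text \<open>Both ranges lie in the span of one finite independent set \<open>C\<close>; in
  coordinates the two traces are the same double sum of products of matrix entries.\<close>

lemma op_trace_comp_commute:
  fixes a b :: "'a::complex_normed_vector \<Rightarrow> 'a"
  assumes a: "a \<in> soc" and b: "b \<in> soc"
  shows "op_trace (a \<circ> b) = op_trace (b \<circ> a)"
proof -
  obtain A B where A: "finite A" "range a \<subseteq> complex_vector.span A"
    and B: "finite B" "range b \<subseteq> complex_vector.span B"
    using assms by (auto simp: soc_def)
  obtain C where C: "C \<subseteq> A \<union> B" "complex_vector.independent C"
    "A \<union> B \<subseteq> complex_vector.span C"
    using complex_vector.maximal_independent_subset by blast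
  have fin: "finite C"
    using C(1) A(1) B(1) finite_subset by blast
  have "complex_vector.span A \<subseteq> complex_vector.span C" "complex_vector.span B \<subseteq> complex_vector.span C"
    using C(3) by (simp_all add: complex_vector.span_minimal)
  then have aC: "a x \<in> complex_vector.span C" and bC: "b x \<in> complex_vector.span C" for x
    using A(2) B(2) by blast+
  let ?r = "complex_vector.representation C"
  have expand: "?r (p (q c)) c = (\<Sum>d\<in>C. ?r (q c) d * ?r (p d) c)"
    if p: "p \<in> soc" "\<And>x. p x \<in> complex_vector.span C" and q: "\<And>x. q x \<in> complex_vector.span C"
    for p q :: "'a \<Rightarrow> 'a" and c
  proof -
    interpret Vector_Spaces.linear scaleC scaleC p
      using p by (intro bounded_ops_linear soc_bounded_ops)
    have "p (q c) = p (\<Sum>d\<in>C. ?r (q c) d *\<^sub>C d)"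
      using complex_vector.sum_representation_eq[OF C(2) q fin] by simp
    also have "\<dots> = (\<Sum>d\<in>C. ?r (q c) d *\<^sub>C p d)"
      by (simp add: sum scale)
    finally show ?thesis
      using p(2) by (simp add: complex_vector.representation_sum[OF C(2)]
          complex_vector.representation_scale[OF C(2)] complex_vector.span_scale)
  qed
  have "op_trace (a \<circ> b) = (\<Sum>c\<in>C. \<Sum>d\<in>C. ?r (b c) d * ?r (a d) c)"
    using aC bC expand[where q = b, OF a aC bC]
    by (simp add: op_trace_eq_superset[OF soc_comp[OF a b] C(2) fin] image_subset_iff trace_wrt_def)
  also have "\<dots> = (\<Sum>d\<in>C. \<Sum>c\<in>C. ?r (a d) c * ?r (b c) d)"
    by (subst sum.swap) (simp add: mult.commute)
  also have "\<dots> = op_trace (b \<circ> a)"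
    using aC bC expand[where q = a, OF b bC aC]
    by (simp add: op_trace_eq_superset[OF soc_comp[OF b a] C(2) fin] image_subset_iff trace_wrt_def)
  finally show ?thesis .
qed

text \<open>Induction on the degree bound: split off a root, \<open>p = [:- l, 1:] * q\<close>.
  Either \<open>a v = l *\<^sub>C v\<close>, or \<open>q\<close> annihilates the nonzero vector
  \<open>a v - l *\<^sub>C v\<close> of \<open>V\<close>.\<close>

lemma eigenvector_of_annihilating_polynomial:
  fixes a :: "'a::complex_normed_vector \<Rightarrow> 'a"
  assumes lin: "Vector_Spaces.linear scaleC scaleC a"
    and V: "complex_vector.subspace V" "a ` V \<subseteq> V"
    and v: "v \<in> V" "v \<noteq> 0"
    and p: "p \<noteq> 0" "degree p \<le> n" "(\<Sum>i\<le>n. coeff p i *\<^sub>C (a ^^ i) v) = 0"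
  shows "\<exists>w\<in>V. w \<noteq> 0 \<and> (\<exists>l. a w = l *\<^sub>C w)"
  using v p
proof (induction n arbitrary: v p)
  case 0
  then show ?case
    using leading_coeff_neq_0[of p] by simp
next
  case (Suc n)
  interpret Vector_Spaces.linear scaleC scaleC a
    by (rule lin)
  show ?case
  proof (cases "degree p \<le> n")
    case True
    then have "(\<Sum>i\<le>n. coeff p i *\<^sub>C (a ^^ i) v) = 0"
      using Suc.prems(5) by (simp add: coeff_eq_0)
    then show ?thesis
      using Suc.IH[OF Suc.prems(1-3) True] by blast
  next
    case False
    then have deg: "degree p = Suc n"
      using Suc.prems(4) by simp
    then obtain l where "poly p l = 0"
      using alg_closed_imp_poly_has_root[of p] by auto
    then obtain q where pq: "p = [:- l, 1:] * q"
      by (auto simp: poly_eq_0_iff_dvd)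
    then have q: "q \<noteq> 0" "degree q \<le> n"
      using Suc.prems(3) deg by (auto simp: degree_mult_eq simp del: mult_pCons_left)
    let ?w = "a v - l *\<^sub>C v"
    have pow: "(a ^^ i) (x - c *\<^sub>C y) = (a ^^ i) x - c *\<^sub>C (a ^^ i) y" for i c x y
      by (induction i) (simp_all add: diff scale)
    have "(\<Sum>i\<le>n. coeff q i *\<^sub>C (a ^^ i) ?w)
        = (\<Sum>i\<le>n. coeff q i *\<^sub>C (a ^^ Suc i) v) - (\<Sum>i\<le>n. (l * coeff q i) *\<^sub>C (a ^^ i) v)"
      by (simp add: pow complex_vector.scale_right_diff_distrib sum_subtractf
          mult.commute funpow_swap1)
    \<comment> \<open>Both sums are brought to the range \<open>i \<le> Suc n\<close>: the first by
      an index shift with 0 as new entry at index 0, the second because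
      \<open>coeff q (Suc n)\<close> is 0. The differences of the coefficients are those of
      \<open>p\<close>.\<close>
    also have "(\<Sum>i\<le>n. coeff q i *\<^sub>C (a ^^ Suc i) v)
        = (\<Sum>i\<le>Suc n. (if i = 0 then 0 else coeff q (i - 1)) *\<^sub>C (a ^^ i) v)"
      by (subst sum.atMost_Suc_shift) simp
    also have "(\<Sum>i\<le>n. (l * coeff q i) *\<^sub>C (a ^^ i) v)
        = (\<Sum>i\<le>Suc n. (l * coeff q i) *\<^sub>C (a ^^ i) v)"
      using q(2) by (simp add: coeff_eq_0)
    also have "(\<Sum>i\<le>Suc n. (if i = 0 then 0 else coeff q (i - 1)) *\<^sub>C (a ^^ i) v) - \<dots>
        = (\<Sum>i\<le>Suc n. coeff p i *\<^sub>C (a ^^ i) v)"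
      unfolding sum_subtractf[symmetric] complex_vector.scale_left_diff_distrib[symmetric] pq
      by (intro sum.cong refl) (simp add: coeff_pCons split: nat.split)
    finally have sum: "(\<Sum>i\<le>n. coeff q i *\<^sub>C (a ^^ i) ?w) = 0"
      using Suc.prems(5) by simp
    show ?thesis
    proof (cases "?w = 0")
      case True
      then show ?thesis
        using Suc.prems(1,2) by auto
    next
      case False
      moreover have "?w \<in> V"
        using Suc.prems(1) V
        by (intro complex_vector.subspace_diff complex_vector.subspace_scale) auto
      ultimately show ?thesis
        using Suc.IH q sum by blast
    qed
  qed
qed

text \<open>By finite dimension some iterate \<open>(a ^^ k) v\<close> depends linearly on the
  earlier ones, and this relation is a polynomial annihilating \<open>v\<close>.\<close>

lemma eigenvector_exists:
  fixes a :: "'a::complex_normed_vector \<Rightarrow> 'a"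
  assumes lin: "Vector_Spaces.linear scaleC scaleC a"
    and B: "finite B" and inv: "a ` complex_vector.span B \<subseteq> complex_vector.span B"
    and v: "v \<in> complex_vector.span B" "v \<noteq> 0"
  shows "\<exists>w\<in>complex_vector.span B. w \<noteq> 0 \<and> (\<exists>l. a w = l *\<^sub>C w)"
proof -
  let ?g = "\<lambda>i. (a ^^ i) v"
  have gV: "?g i \<in> complex_vector.span B" for i
    using inv v(1) by (induction i) auto
  have "\<exists>k. ?g k \<in> complex_vector.span (?g ` {..<k})"
  proof (rule ccontr)
    assume "\<not> ?thesis"
    \<comment> \<open>Iterates that never depend on the earlier ones are distinct and independent,
      impossible for \<open>card B + 1\<close> vectors in the span of \<open>B\<close>.\<close>
    then have new: "?g k \<notin> complex_vector.span (?g ` {..<k})" for k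
      by blast
    have indep: "complex_vector.independent (?g ` {..<k}) \<and> card (?g ` {..<k}) = k" for k
    proof (induction k)
      case (Suc k)
      moreover have "?g k \<notin> ?g ` {..<k}"
        by (rule contrapos_nn[OF new]) (rule complex_vector.span_base)
      ultimately show ?case
        using new[of k] by (simp add: lessThan_Suc complex_vector.independent_insertI)
    qed (simp add: complex_vector.independent_empty)
    have "card (?g ` {..<Suc (card B)}) \<le> card B"
      using complex_vector.independent_span_bound[OF B, of "?g ` {..<Suc (card B)}"]
        indep[of "Suc (card B)"] gV by (auto simp del: lessThan_Suc)
    then show False
      using indep[of "Suc (card B)"] by simp
  qed
  then obtain k u where u: "?g k = (\<Sum>i<k. u i *\<^sub>C ?g i)"
    using span_image_finite_sum[of "{..<_}"] by blast
  \<comment> \<open>The monic polynomial of the relation; its coefficient 1 at \<open>k\<close>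
    makes it nonzero.\<close>
  let ?p = "monom 1 k - (\<Sum>i<k. monom (u i) i)"
  have coeff: "coeff ?p i = (if i = k then 1 else 0) - (if i < k then u i else 0)" for i
    by (simp add: coeff_sum)
  have "coeff ?p k = 1"
    by (simp only: coeff) simp
  then have "?p \<noteq> 0"
    by (metis coeff_0 zero_neq_one)
  moreover have "degree ?p \<le> k"
    by (rule degree_le) (simp only: coeff, simp)
  moreover have "(\<Sum>i\<le>k. coeff ?p i *\<^sub>C ?g i) = 0"
    unfolding coeff using u by (simp add: lessThan_Suc_atMost[symmetric] sum_negf)
  ultimately show ?thesis
    using eigenvector_of_annihilating_polynomial[OF lin complex_vector.subspace_span inv v] by blast
qed

text \<open>If \<open>l\<close> is an eigenvalue of \<open>a\<close> on \<open>V\<close> then \<open>(a - l) V\<close> is a proper subspace, and every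
  hyperplane of \<open>V\<close> containing it is invariant under \<open>a\<close>.\<close>

lemma trace_wrt_eq_sum_eigenvalues:
  fixes a :: "'a::complex_normed_vector \<Rightarrow> 'a"
  assumes a: "a \<in> bounded_ops"
    and B: "complex_vector.independent B" "finite B"
    and inv: "a ` complex_vector.span B \<subseteq> complex_vector.span B"
  shows "\<exists>ls. length ls = card B \<and> trace_wrt B a = sum_list ls \<and>
    (\<forall>l\<in>set ls. \<exists>v. v \<noteq> 0 \<and> a v = l *\<^sub>C v)"
  using B inv
proof (induction "card B" arbitrary: B)
  case 0
  then show ?case
    by (simp add: trace_wrt_def)
next
  case (Suc n)
  interpret Vector_Spaces.linear scaleC scaleC a
    using a by (rule bounded_ops_linear)
  let ?V = "complex_vector.span B"
  obtain b where b: "b \<in> B"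
    using Suc.hyps(2) by fastforce
  moreover have "b \<noteq> 0"
    using b Suc.prems(1) complex_vector.dependent_zero by blast
  ultimately obtain v l where v: "v \<in> ?V" "v \<noteq> 0" "a v = l *\<^sub>C v"
    using eigenvector_exists[OF bounded_ops_linear[OF a] Suc.prems(2,3)]
      complex_vector.span_base by blast
  have "complex_vector.independent {v}"
    using v(2) by simp
  moreover have "{v} \<subseteq> ?V"
    using v(1) by simp
  ultimately obtain D where "{v} \<subseteq> D"
    and D: "finite D" "complex_vector.span D = ?V" "card D = Suc n"
    using extend_basis_of_span[OF Suc.prems(1,2)] Suc.hyps(2) by metis
  then have vD: "v \<in> D"
    by blast
  let ?s = "\<lambda>x. a x - l *\<^sub>C x"
  interpret s: Vector_Spaces.linear scaleC scaleC ?s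
    by unfold_locales
      (simp_all add: add scale scaleC_add_right complex_vector.scale_right_diff_distrib mult.commute)
  have sV: "?s x \<in> ?V" if "x \<in> ?V" for x
    using that Suc.prems(3)
    by (intro complex_vector.span_diff complex_vector.span_scale) auto
  \<comment> \<open>\<open>D\<close> spans the space, has \<open>n + 1\<close> elements and contains
    the eigenvector \<open>v\<close>, which \<open>?s\<close> kills; the other \<open>n\<close>
    images span the image of \<open>?s\<close>, so that \<open>card E \<le> n\<close>.\<close>
  have "?s ` ?V = complex_vector.span (?s ` D)"
    using s.span_image[of D] D(2) by simp
  also have "?s ` D = insert 0 (?s ` (D - {v}))"
    using vD v(3) by (auto simp: image_iff)
  finally have sspan: "?s ` ?V = complex_vector.span (?s ` (D - {v}))"
    by (simp only: complex_vector.span_insert_0)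
  obtain E where E: "E \<subseteq> ?s ` ?V" "complex_vector.independent E" "?s ` ?V \<subseteq> complex_vector.span E"
    using complex_vector.maximal_independent_subset by blast
  have "card E \<le> card (?s ` (D - {v}))"
    using complex_vector.independent_span_bound[of "?s ` (D - {v})" E] E(1,2) sspan D(1) by auto
  also have "\<dots> \<le> n"
    using card_image_le[of "D - {v}" ?s] D vD by simp
  finally have cardE: "card E \<le> n" .
  have "E \<subseteq> ?V"
    using E(1) sV by blast
  then obtain F where F: "E \<subseteq> F" "complex_vector.independent F" "finite F"
    "complex_vector.span F = ?V" "card F = Suc n"
    using extend_basis_of_span[OF Suc.prems(1,2) E(2)] Suc.hyps(2) by metis
  \<comment> \<open>The basis \<open>F\<close> extends \<open>E\<close> and is larger than it.
    Without \<open>w\<close> it still contains \<open>E\<close>, so it spans a hyperplane containing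
    the image of \<open>?s\<close>.\<close>
  obtain w where w: "w \<in> F" "w \<notin> E"
    using F(1,5) cardE by (metis Suc_n_not_le_n subsetI subset_antisym)
  let ?C = "F - {w}"
  let ?W = "complex_vector.span ?C"
  have C: "complex_vector.independent ?C" "finite ?C" "card ?C = n"
    using F w complex_vector.independent_mono[OF F(2)] by auto
  have "?s ` ?V \<subseteq> ?W"
    using E(3) complex_vector.span_mono[of E ?C] F(1) w by blast
  then have sW: "?s x \<in> ?W" if "x \<in> ?V" for x
    using that by blast
  have WV: "?W \<subseteq> ?V"
    using complex_vector.span_mono[of ?C F] F(4) by auto
  have aW: "a x \<in> ?W" if "x \<in> ?W" for x
  proof -
    have "?s x + l *\<^sub>C x \<in> ?W"
      using that sW WV by (intro complex_vector.span_add complex_vector.span_scale) auto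
    then show ?thesis
      by simp
  qed
  have wV: "w \<in> ?V"
    using w F(4) complex_vector.span_base by blast
  have "trace_wrt F a = complex_vector.representation F (a w) w
      + (\<Sum>c\<in>?C. complex_vector.representation F (a c) c)"
    unfolding trace_wrt_def using F(3) w(1) by (rule sum.remove)
  also have "(\<Sum>c\<in>?C. complex_vector.representation F (a c) c) = trace_wrt ?C a"
    unfolding trace_wrt_def
  proof (rule sum.cong[OF refl])
    fix c assume "c \<in> ?C"
    then have "a c \<in> ?W"
      by (intro aW complex_vector.span_base)
    then show "complex_vector.representation F (a c) c = complex_vector.representation ?C (a c) c"
      using complex_vector.representation_extend[OF F(2), of "a c" ?C] by auto
  qed
  \<comment> \<open>\<open>?s w\<close> lies in the span of \<open>F - {w}\<close>, so its
    coordinate at \<open>w\<close> is 0 and only that of \<open>l *\<^sub>C w\<close>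
    remains.\<close>
  also have "complex_vector.representation F (a w) w = l"
  proof -
    have "complex_vector.representation F (?s w) w = complex_vector.representation ?C (?s w) w"
      using complex_vector.representation_extend[OF F(2) sW[OF wV]] by auto
    also have "\<dots> = 0"
      using complex_vector.representation_ne_zero[of ?C "?s w" w] by blast
    finally have "complex_vector.representation F (?s w + l *\<^sub>C w) w = l"
      using sV[OF wV] wV F(2,4) w(1)
      by (subst complex_vector.representation_add)
        (auto simp: complex_vector.representation_scale complex_vector.representation_basis
          complex_vector.span_scale)
    then show ?thesis
      by simp
  qed
  finally have "trace_wrt F a = l + trace_wrt ?C a" .
  moreover have "trace_wrt B a = trace_wrt F a"
    using a Suc.prems F by (intro trace_wrt_basis_change) auto
  moreover have "a ` ?W \<subseteq> ?W"
    using aW by blast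
  then obtain ls where ls: "length ls = n" "trace_wrt ?C a = sum_list ls"
    "\<forall>l\<in>set ls. \<exists>v. v \<noteq> 0 \<and> a v = l *\<^sub>C v"
    using Suc.hyps(1)[of ?C] C by auto
  ultimately show ?case
    using v ls Suc.hyps(2) by (intro exI[of _ "l # ls"]) auto
qed

text \<open>The range is invariant under \<open>a\<close> and its dimension is the rank. Entries of
  the list may repeat and may be 0.\<close>

lemma op_trace_eq_sum_eigenvalues:
  assumes a: "a \<in> soc"
  obtains ls where "length ls = op_rank a" "op_trace a = sum_list ls"
    "\<And>l. l \<in> set ls \<Longrightarrow> \<exists>v. v \<noteq> 0 \<and> a v = l *\<^sub>C v"
proof -
  obtain B where B: "complex_vector.independent B" "finite B" "complex_vector.span B = range a"
    using soc_range_basis[OF a] .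
  have rank: "op_rank a = card B"
    using complex_vector.dim_span_eq_card_independent[OF B(1)] unfolding B(3) op_rank_def .
  have inv: "a ` complex_vector.span B \<subseteq> complex_vector.span B"
    unfolding B(3) by blast
  obtain ls where "length ls = card B" "trace_wrt B a = sum_list ls"
    "\<forall>l\<in>set ls. \<exists>v. v \<noteq> 0 \<and> a v = l *\<^sub>C v"
    using trace_wrt_eq_sum_eigenvalues[OF soc_bounded_ops[OF a] B(1,2) inv] by blast
  then show thesis
    using that[of ls] rank op_trace_eq[OF a B(1,3)] by simp
qed

text \<open>An eigenvector satisfies \<open>l ^ n *\<^sub>C v = 0\<close>, so every eigenvalue in
  the sum is zero.\<close>

lemma op_trace_nilpotent:
  assumes a: "a \<in> soc" and nil: "op_nilpotent a"
  shows "op_trace a = 0"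
proof -
  interpret Vector_Spaces.linear scaleC scaleC a
    using a by (intro bounded_ops_linear soc_bounded_ops)
  obtain ls where ls: "op_trace a = sum_list ls"
    "\<And>l. l \<in> set ls \<Longrightarrow> \<exists>v. v \<noteq> 0 \<and> a v = l *\<^sub>C v"
    using op_trace_eq_sum_eigenvalues[OF a] by metis
  obtain n where n: "a ^^ n = (\<lambda>x. 0)"
    using nil by (auto simp: op_nilpotent_def)
  have "l = 0" if l: "l \<in> set ls" for l
  proof -
    obtain v where v: "v \<noteq> 0" "a v = l *\<^sub>C v"
      using ls(2)[OF l] by blast
    have "(a ^^ k) v = l ^ k *\<^sub>C v" for k
      by (induction k) (simp_all add: scale v(2) mult.commute)
    from this[of n] show ?thesis
      using n v(1) by simp
  qed
  then have "sum_list ls = 0"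
    by (induction ls) auto
  then show ?thesis
    using ls(1) by simp
qed

subsection \<open>The spectral radius\<close>

text \<open>An inverse would map \<open>l *\<^sub>C v - a v\<close>, which is 0, back to
  \<open>v\<close>.\<close>

lemma eigenvalue_in_spectrum:
  assumes "v \<noteq> 0" "a v = l *\<^sub>C v"
  shows "l \<in> op_spectrum a"
proof -
  have False if b: "b \<in> bounded_ops" "b \<circ> (\<lambda>x. l *\<^sub>C x - a x) = id" for b
  proof -
    interpret Vector_Spaces.linear scaleC scaleC b
      using b(1) by (rule bounded_ops_linear)
    have "b (l *\<^sub>C v - a v) = v"
      using b(2) by (simp add: fun_eq_iff)
    then show False
      using assms by (simp add: zero)
  qed
  then show ?thesis
    by (auto simp: op_spectrum_def op_invertible_def)
qed

lemma bounded_ops_scale_diff: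
  assumes "a \<in> bounded_ops"
  shows "(\<lambda>x. l *\<^sub>C x - a x) \<in> bounded_ops"
  using assms
  by (auto simp: bounded_ops_def bounded_linear_sub bounded_linear_scaleC_right
      mult.commute complex_vector.scale_right_diff_distrib)

text \<open>Bounds the spectrum by \<open>onorm a\<close>. The estimate \<open>lower\<close> gives
  injectivity and a bound for the inverse; surjectivity comes from completeness.\<close>

lemma op_invertible_large:
  fixes a :: "'a::complex_banach \<Rightarrow> 'a"
  assumes a: "a \<in> bounded_ops" and l: "onorm a < cmod l"
  shows "op_invertible (\<lambda>x. l *\<^sub>C x - a x)"
proof -
  let ?s = "\<lambda>x. l *\<^sub>C x - a x"
  have bl: "bounded_linear a"
    using a by (simp add: bounded_ops_def)
  have s: "?s \<in> bounded_ops"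
    using a by (rule bounded_ops_scale_diff)
  interpret s: Vector_Spaces.linear scaleC scaleC ?s
    using s by (rule bounded_ops_linear)
  have pos: "cmod l > 0"
    using l onorm_pos_le[OF bl] by linarith
  have lower: "(cmod l - onorm a) * norm x \<le> norm (?s x)" for x
  proof -
    have "cmod l * norm x - norm (a x) \<le> norm (?s x)"
      using norm_triangle_ineq2[of "l *\<^sub>C x" "a x"] by (simp add: norm_scaleC)
    then show ?thesis
      using onorm[OF bl, of x] by (simp add: algebra_simps)
  qed
  have inj: "x = y" if "?s x = ?s y" for x y
  proof -
    have "?s (x - y) = 0"
      using that by (simp only: s.diff) simp
    then have "(cmod l - onorm a) * norm (x - y) \<le> 0"
      using lower[of "x - y"] by simp
    then show ?thesis
      using l by (simp add: mult_le_0_iff)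
  qed
  have surj: "\<exists>x. ?s x = y" for y
  proof -
    \<comment> \<open>A solution of \<open>?s x = y\<close> is a fixed point of \<open>?T\<close>, a
      contraction with factor \<open>onorm a / cmod l\<close>.\<close>
    let ?T = "\<lambda>x. inverse l *\<^sub>C (y + a x)"
    have "\<exists>!x. ?T x = x"
    proof (rule banach_fix_type[where c = "onorm a / cmod l"])
      show "0 \<le> onorm a / cmod l" "onorm a / cmod l < 1"
        using pos l onorm_pos_le[OF bl] by simp_all
      show "\<forall>x z. dist (?T x) (?T z) \<le> onorm a / cmod l * dist x z"
      proof (intro allI)
        fix x z
        have "?T x - ?T z = inverse l *\<^sub>C a (x - z)"
          using bl by (simp add: linear_simps flip: complex_vector.scale_right_diff_distrib)
        then have "dist (?T x) (?T z) = norm (inverse l *\<^sub>C a (x - z))"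
          by (simp only: dist_norm)
        also have "\<dots> = norm (a (x - z)) / cmod l"
          by (simp add: norm_scaleC norm_inverse divide_inverse mult.commute)
        also have "\<dots> \<le> onorm a * norm (x - z) / cmod l"
          using onorm[OF bl, of "x - z"] pos by (simp add: divide_right_mono)
        finally show "dist (?T x) (?T z) \<le> onorm a / cmod l * dist x z"
          by (simp add: dist_norm)
      qed
    qed
    then obtain x where "?T x = x"
      by blast
    then have "l *\<^sub>C x = l *\<^sub>C ?T x"
      by simp
    also have "\<dots> = y + a x"
      using pos by simp
    finally show ?thesis
      by (intro exI[of _ x]) simp
  qed
  \<comment> \<open>A preimage is chosen for each \<open>y\<close>; injectivity of \<open>?s\<close>
    makes \<open>b\<close> linear and also a left inverse.\<close>
  obtain b where b: "\<And>y. ?s (b y) = y"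
    using surj by metis
  have b': "b (?s x) = x" for x
    by (rule inj) (rule b)
  have hom: "b (c *\<^sub>C y) = c *\<^sub>C b y" for c y
    by (rule inj) (simp only: b s.scale)
  have "bounded_linear b"
  proof (rule bounded_linear_intro[where K = "inverse (cmod l - onorm a)"])
    show "b (x + y) = b x + b y" for x y
      by (rule inj) (simp only: b s.add)
    show "b (r *\<^sub>R x) = r *\<^sub>R b x" for r x
      using hom[of "complex_of_real r" x] by (simp add: scaleC_of_real)
    show "norm (b x) \<le> norm x * inverse (cmod l - onorm a)" for x
      using lower[of "b x"] l b[of x] by (simp add: field_simps)
  qed
  then have "b \<in> bounded_ops"
    using hom by (simp add: bounded_ops_def)
  then show ?thesis
    unfolding op_invertible_def using s b b' by (intro conjI bexI[of _ b]) (auto simp: fun_eq_iff)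
qed

text \<open>The supremum dominates its members because the spectrum is bounded, by
  \<open>onorm a\<close>.\<close>

lemma eigenvalue_le_spectral_radius:
  fixes a :: "'a::complex_banach \<Rightarrow> 'a"
  assumes "a \<in> bounded_ops" "v \<noteq> 0" "a v = l *\<^sub>C v"
  shows "cmod l \<le> op_spectral_radius a"
  unfolding op_spectral_radius_def
proof (rule cSUP_upper)
  show "l \<in> op_spectrum a"
    using assms(2,3) by (rule eigenvalue_in_spectrum)
  show "bdd_above (cmod ` op_spectrum a)"
    using op_invertible_large[OF assms(1)]
    by (intro bdd_aboveI2[where M = "onorm a"]) (force simp: op_spectrum_def)
qed

text \<open>Triangle inequality over the eigenvalues. On the zero space the list is empty and the
  unspecified spectral radius is multiplied by 0.\<close>

lemma norm_op_trace_le: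
  fixes a :: "'a::complex_banach \<Rightarrow> 'a"
  assumes a: "a \<in> soc"
  shows "cmod (op_trace a) \<le> real (op_rank a) * op_spectral_radius a"
proof -
  obtain ls where ls: "length ls = op_rank a" "op_trace a = sum_list ls"
    "\<And>l. l \<in> set ls \<Longrightarrow> \<exists>v. v \<noteq> 0 \<and> a v = l *\<^sub>C v"
    using op_trace_eq_sum_eigenvalues[OF a] by metis
  have "cmod l \<le> op_spectral_radius a" if "l \<in> set ls" for l
    using ls(3)[OF that] eigenvalue_le_spectral_radius[OF soc_bounded_ops[OF a]] by blast
  then have "cmod (sum_list ls) \<le> real (length ls) * op_spectral_radius a"
  proof (induction ls)
    case (Cons l ls)
    then show ?case
      using norm_triangle_ineq[of l "sum_list ls"] by (force simp: algebra_simps)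
  qed simp
  then show ?thesis
    using ls by simp
qed

text \<open>For nonzero \<open>l\<close> the Neumann series of the inverse stops after two terms, so
  the spectrum lies in \<open>{0}\<close>; the kernel vector \<open>v\<close> puts 0 into it, which
  rules out a supremum over the empty set.\<close>

lemma op_spectral_radius_square_zero:
  fixes a :: "'a::complex_normed_vector \<Rightarrow> 'a"
  assumes a: "a \<in> bounded_ops" "a \<circ> a = (\<lambda>x. 0)" and v: "v \<noteq> 0" "a v = 0"
  shows "op_spectral_radius a = 0"
proof -
  interpret Vector_Spaces.linear scaleC scaleC a
    using a(1) by (rule bounded_ops_linear)
  have aa: "a (a x) = 0" for x
    using a(2) by (simp add: fun_eq_iff)
  have "op_invertible (\<lambda>x. l *\<^sub>C x - a x)" if l: "l \<noteq> 0" for l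
  proof -
    let ?b = "\<lambda>x. inverse l *\<^sub>C x - (- inverse (l\<^sup>2)) *\<^sub>C a x"
    have "(\<lambda>x. (- inverse (l\<^sup>2)) *\<^sub>C a x) \<in> bounded_ops"
      using a(1) bounded_linear_compose[OF bounded_linear_scaleC_right]
      by (auto simp: bounded_ops_def mult.commute simp del: complex_vector.scale_minus_left)
    then have "?b \<in> bounded_ops"
      by (rule bounded_ops_scale_diff)
    moreover have "(\<lambda>x. l *\<^sub>C x - a x) \<circ> ?b = id" "?b \<circ> (\<lambda>x. l *\<^sub>C x - a x) = id"
      using l by (auto simp: fun_eq_iff add diff scale aa scaleC_add_right
          complex_vector.scale_right_diff_distrib power2_eq_square)
    ultimately show ?thesis
      unfolding op_invertible_def using bounded_ops_scale_diff[OF a(1)] by blast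
  qed
  then have "op_spectrum a \<subseteq> {0}"
    by (auto simp: op_spectrum_def)
  moreover have "0 \<in> op_spectrum a"
    using v by (intro eigenvalue_in_spectrum[of v]) simp_all
  ultimately have "op_spectrum a = {0}"
    by blast
  then show ?thesis
    by (simp add: op_spectral_radius_def)
qed

section \<open>Equivalence of the five conditions\<close>

theorem theorem3p13:
  fixes f :: "('a::complex_banach \<Rightarrow> 'a) \<Rightarrow> complex"
  assumes "soc_functional f"
  defines "condA \<equiv> \<exists>\<alpha>. \<forall>a\<in>soc. f a = \<alpha> * op_trace a"
    and "condB \<equiv> \<forall>a\<in>soc. \<forall>b\<in>soc. f (a \<circ> b) = f (b \<circ> a)"
    and "condC \<equiv> \<exists>c::real. c > 0 \<and>
           (\<forall>a\<in>soc. cmod (f a) \<le> c * real (op_rank a) * op_spectral_radius a)"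
    and "condD \<equiv> \<forall>a\<in>soc. op_nilpotent a \<longrightarrow> f a = 0"
    and "condE \<equiv> \<forall>a\<in>soc. a \<circ> a = (\<lambda>x. 0) \<longrightarrow> f a = 0"
  shows "(condA \<longleftrightarrow> condB) \<and> (condA \<longleftrightarrow> condC) \<and> (condA \<longleftrightarrow> condD) \<and> (condA \<longleftrightarrow> condE)"
proof -
  note f = assms(1)
  have AB: condB if condA
    using that op_trace_comp_commute soc_comp unfolding condA_def condB_def by metis
  have AC: condC if A: condA
  proof -
    obtain \<alpha> where \<alpha>: "\<And>a. a \<in> soc \<Longrightarrow> f a = \<alpha> * op_trace a"
      using A unfolding condA_def by blast
    \<comment> \<open>The summand 1 keeps the constant positive when \<open>\<alpha>\<close> is
      0.\<close>
    have "cmod (f a) \<le> (cmod \<alpha> + 1) * real (op_rank a) * op_spectral_radius a"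
      if a: "a \<in> soc" for a
    proof -
      have "cmod (f a) \<le> (cmod \<alpha> + 1) * cmod (op_trace a)"
        by (simp add: \<alpha>[OF a] norm_mult mult_right_mono)
      also have "\<dots> \<le> (cmod \<alpha> + 1) * (real (op_rank a) * op_spectral_radius a)"
        using norm_op_trace_le[OF a] by (intro mult_left_mono) auto
      finally show ?thesis
        by (simp add: mult.assoc)
    qed
    moreover have "cmod \<alpha> + 1 > 0"
      by (simp add: add_nonneg_pos)
    ultimately show ?thesis
      unfolding condC_def by blast
  qed
  have AD: condD if condA
    using that op_trace_nilpotent unfolding condA_def condD_def by fastforce
  have DE: condE if condD
  proof -
    have "op_nilpotent a" if "a \<circ> a = (\<lambda>x. 0)" for a :: "'a \<Rightarrow> 'a"
      using that by (auto simp: op_nilpotent_def numeral_2_eq_2 intro!: exI[of _ 2])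
    then show ?thesis
      using that unfolding condD_def condE_def by blast
  qed
  have EA: condA if condE
    unfolding condA_def
  proof (rule functional_multiple_of_trace[OF f])
    fix \<phi> and x :: 'a assume "bounded_functional \<phi>" "\<phi> x = 0"
    then show "f (rank_one x \<phi>) = 0"
      using that rank_one_soc rank_one_square unfolding condE_def by blast
  qed
  have CA: condA if condC
    unfolding condA_def
  proof (rule functional_multiple_of_trace[OF f])
    fix \<phi> and x :: 'a assume \<phi>: "bounded_functional \<phi>" "\<phi> x = 0"
    show "f (rank_one x \<phi>) = 0"
    proof (cases "x = 0")
      case True
      then show ?thesis
        using soc_functional_zero[OF f] by (simp add: rank_one_def[abs_def])
    next
      case False
      \<comment> \<open>The nonzero vector \<open>x\<close> itself lies in the kernel, so the
        spectral radius is 0 and the bound in \<open>condC\<close> forces \<open>f\<close> to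
        vanish.\<close>
      have "rank_one x \<phi> x = 0"
        using \<phi>(2) by (simp add: rank_one_def)
      then have "op_spectral_radius (rank_one x \<phi>) = 0"
        by (rule op_spectral_radius_square_zero[OF soc_bounded_ops[OF rank_one_soc[OF \<phi>(1)]]
              rank_one_square[OF \<phi>] False])
      then show ?thesis
        using that rank_one_soc[OF \<phi>(1), of x] unfolding condC_def by fastforce
    qed
  qed
  have BA: condA if condB
    unfolding condA_def
  proof (rule functional_multiple_of_trace[OF f])
    fix \<phi> and x :: 'a assume \<phi>: "bounded_functional \<phi>" "\<phi> x = 0"
    \<comment> \<open>With a common functional each product is a multiple of its left factor.
      Exchanging the factors for \<open>x\<close> and any \<open>y\<close> outside the kernel of
      \<open>\<phi>\<close> then forces the value of \<open>f\<close> at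
      \<open>rank_one x \<phi>\<close> to be 0.\<close>
    have comp: "rank_one y \<phi> \<circ> rank_one z \<phi> = (\<lambda>u. \<phi> z *\<^sub>C rank_one y \<phi> u)" for y z
      using \<phi>(1) by (simp add: rank_one_def bounded_functional_def fun_eq_iff mult.commute)
    have swap: "\<phi> y * f (rank_one x \<phi>) = \<phi> x * f (rank_one y \<phi>)" for y
      using that rank_one_soc[OF \<phi>(1)] comp soc_functional_scale[OF f] unfolding condB_def by metis
    show "f (rank_one x \<phi>) = 0"
    proof (cases "\<exists>y. \<phi> y \<noteq> 0")
      case True
      then show ?thesis
        using swap \<phi>(2) by auto
    next
      case False
      then show ?thesis
        using soc_functional_zero[OF f] by (simp add: rank_one_def[abs_def])
    qed
  qed
  show ?thesis
    using AB AC AD DE EA CA BA by blast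
qed

end
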